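(* Suppose that a domain $\Omega\subset E_k$ is convex with respect to the set of directions $M_u$ and $f_u(E_k)=\mathbb{C}$ for all $u=1,\ldots,m$. Then every monogenic function $\Phi:\Omega\to\mathbb{A}_n^m$ can be continued to a function monogenic in the domain $\Pi:=\{\zeta\in E_k: f_u(\zeta)\in D_u \text{ for all } u=1,\ldots,m\}$.
   Context: Fix integers $1\le m\le n$. $\mathbb{A}_n^m$ is an $n$-dimensional commutative associative algebra with unit over $\mathbb{C}$ having a basis $\{I_r\}_{r=1}^n$ with the multiplication rules: (1) for $r,s\in\{1,\ldots,m\}$: $I_rI_s=0$ if $r\ne s$ and $I_rI_r=I_r$; (2) for $r,s\in\{m+1,\ldots,n\}$: $I_rI_s=\sum_{p=\max\{r,s\}+1}^n\Upsilon^s_{r,p}I_p$ with $\Upsilon^s_{r,p}\in\mathbb{C}$; (3) for each $s\in\{m+1,\ldots,n\}$ there is a unique $u_s\in\{1,\ldots,m\}$ such that for all $r\in\{1,\ldots,m\}$: $I_rI_s=I_s$ if $r=u_s$ and $I_rI_s=0$ otherwise. For $u=1,\ldots,m$, $f_u:\mathbb{A}_n^m\to\mathbb{C}$ is the linear functional $f_u(\sum_r\lambda_rI_r)=\lambda_u$. Let $2\le k\le 2n$ and let $e_1=1=\sum_{r=1}^mI_r$, $e_j=\sum_{r=1}^n a_{jr}I_r$ ($j=2,\ldots,k$) be linearly independent over $\mathbb{R}$; $E_k$ is their real linear span. $M_u:=\{\zeta\in E_k: f_u(\zeta)=0\}$. A domain $\Omega\subset E_k$ is convex with respect to the set of directions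 $M_u$ if for all $\zeta_1,\zeta_2\in\Omega$ with $\zeta_2-\zeta_1\in M_u$ the segment joining them lies in $\Omega$. $D_u:=f_u(\Omega)$. A continuous function $\Phi:\Omega\to\mathbb{A}_n^m$ is monogenic in $\Omega$ if for every $\zeta\in\Omega$ there is $\Phi'(\zeta)\in\mathbb{A}_n^m$ with $\lim_{\varepsilon\to0^+}(\Phi(\zeta+\varepsilon h)-\Phi(\zeta))\varepsilon^{-1}=h\Phi'(\zeta)$ for all $h\in E_k$. *)

theory Defs
  imports "HOL-Analysis.Analysis"
begin

text \<open>Elements of the algebra A_n^m are represented by their coordinate functions
  nat => complex w.r.t. the basis I_1,...,I_n (coordinates outside 1..n are zero).
  The type nat => complex carries the product topology (HOL-Analysis Function_Topology),
  which on the finite-dimensional subspace Alg n is the usual Euclidean topology.\<close>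

definition Alg :: "nat \<Rightarrow> (nat \<Rightarrow> complex) set" where
  "Alg n = {a. \<forall>j. j \<notin> {1..n} \<longrightarrow> a j = 0}"

definition basisI :: "nat \<Rightarrow> nat \<Rightarrow> complex" where
  "basisI r = (\<lambda>p. if p = r then 1 else 0)"

definition vadd :: "(nat \<Rightarrow> complex) \<Rightarrow> (nat \<Rightarrow> complex) \<Rightarrow> (nat \<Rightarrow> complex)" where
  "vadd a b = (\<lambda>p. a p + b p)"

definition vsub :: "(nat \<Rightarrow> complex) \<Rightarrow> (nat \<Rightarrow> complex) \<Rightarrow> (nat \<Rightarrow> complex)" where
  "vsub a b = (\<lambda>p. a p - b p)"

definition vscale :: "real \<Rightarrow> (nat \<Rightarrow> complex) \<Rightarrow> (nat \<Rightarrow> complex)" where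
  "vscale c a = (\<lambda>p. complex_of_real c * a p)"

text \<open>Product of basis elements I_r I_s. Ups s r p stands for the structure constant
  Upsilon^s_{r,p}; us s stands for u_s.\<close>
definition bprod :: "nat \<Rightarrow> nat \<Rightarrow> (nat \<Rightarrow> nat \<Rightarrow> nat \<Rightarrow> complex) \<Rightarrow> (nat \<Rightarrow> nat)
    \<Rightarrow> nat \<Rightarrow> nat \<Rightarrow> (nat \<Rightarrow> complex)" where
  "bprod m n Ups us r s =
     (if r \<le> m \<and> s \<le> m then (if r = s then basisI r else (\<lambda>_. 0))
      else if r \<le> m then (if us s = r then basisI s else (\<lambda>_. 0))
      else if s \<le> m then (if us r = s then basisI r else (\<lambda>_. 0))
      else (\<lambda>p. if max r s < p \<and> p \<le> n then Ups s r p else 0))"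

definition amul :: "nat \<Rightarrow> nat \<Rightarrow> (nat \<Rightarrow> nat \<Rightarrow> nat \<Rightarrow> complex) \<Rightarrow> (nat \<Rightarrow> nat)
    \<Rightarrow> (nat \<Rightarrow> complex) \<Rightarrow> (nat \<Rightarrow> complex) \<Rightarrow> (nat \<Rightarrow> complex)" where
  "amul m n Ups us a b =
     (\<lambda>p. \<Sum>r\<in>{1..n}. \<Sum>s\<in>{1..n}. a r * b s * bprod m n Ups us r s p)"

definition unitA :: "nat \<Rightarrow> nat \<Rightarrow> complex" where
  "unitA m = (\<lambda>p. if 1 \<le> p \<and> p \<le> m then 1 else 0)"

definition is_Anm :: "nat \<Rightarrow> nat \<Rightarrow> (nat \<Rightarrow> nat \<Rightarrow> nat \<Rightarrow> complex) \<Rightarrow> (nat \<Rightarrow> nat) \<Rightarrow> bool" where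
  "is_Anm m n Ups us \<longleftrightarrow>
     1 \<le> m \<and> m \<le> n \<and>
     (\<forall>s\<in>{m+1..n}. us s \<in> {1..m}) \<and>
     (\<forall>a\<in>Alg n. \<forall>b\<in>Alg n. amul m n Ups us a b = amul m n Ups us b a) \<and>
     (\<forall>a\<in>Alg n. \<forall>b\<in>Alg n. \<forall>c\<in>Alg n.
        amul m n Ups us (amul m n Ups us a b) c = amul m n Ups us a (amul m n Ups us b c))"

definition Ek :: "nat \<Rightarrow> (nat \<Rightarrow> nat \<Rightarrow> complex) \<Rightarrow> (nat \<Rightarrow> complex) set" where
  "Ek k e = {(\<lambda>p. \<Sum>j\<in>{1..k}. complex_of_real (x j) * e j p) | x :: nat \<Rightarrow> real. True}"

definition admissible_basis :: "nat \<Rightarrow> nat \<Rightarrow> nat \<Rightarrow> (nat \<Rightarrow> nat \<Rightarrow> complex) \<Rightarrow> bool" where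
  "admissible_basis m n k e \<longleftrightarrow>
     2 \<le> k \<and> k \<le> 2 * n \<and> e 1 = unitA m \<and> (\<forall>j\<in>{2..k}. e j \<in> Alg n) \<and>
     (\<forall>c :: nat \<Rightarrow> real.
        (\<lambda>p. \<Sum>j\<in>{1..k}. complex_of_real (c j) * e j p) = (\<lambda>_. 0) \<longrightarrow> (\<forall>j\<in>{1..k}. c j = 0))"

definition Mdir :: "nat \<Rightarrow> (nat \<Rightarrow> nat \<Rightarrow> complex) \<Rightarrow> nat \<Rightarrow> (nat \<Rightarrow> complex) set" where
  "Mdir k e u = {\<zeta> \<in> Ek k e. \<zeta> u = 0}"

definition is_domain_in :: "(nat \<Rightarrow> complex) set \<Rightarrow> (nat \<Rightarrow> complex) set \<Rightarrow> bool" where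
  "is_domain_in E \<Omega> \<longleftrightarrow> \<Omega> \<subseteq> E \<and> \<Omega> \<noteq> {} \<and> openin (top_of_set E) \<Omega> \<and> connected \<Omega>"

definition convex_wrt :: "(nat \<Rightarrow> complex) set \<Rightarrow> (nat \<Rightarrow> complex) set \<Rightarrow> bool" where
  "convex_wrt M \<Omega> \<longleftrightarrow>
     (\<forall>z1\<in>\<Omega>. \<forall>z2\<in>\<Omega>. vsub z2 z1 \<in> M \<longrightarrow>
        (\<forall>t\<in>{0..1::real}. vadd z1 (vscale t (vsub z2 z1)) \<in> \<Omega>))"

definition Ddom :: "(nat \<Rightarrow> complex) set \<Rightarrow> nat \<Rightarrow> complex set" where
  "Ddom \<Omega> u = (\<lambda>\<zeta>. \<zeta> u) ` \<Omega>"

definition monogenic ::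
  "nat \<Rightarrow> nat \<Rightarrow> (nat \<Rightarrow> nat \<Rightarrow> nat \<Rightarrow> complex) \<Rightarrow> (nat \<Rightarrow> nat) \<Rightarrow> nat \<Rightarrow> (nat \<Rightarrow> nat \<Rightarrow> complex)
    \<Rightarrow> (nat \<Rightarrow> complex) set \<Rightarrow> ((nat \<Rightarrow> complex) \<Rightarrow> (nat \<Rightarrow> complex)) \<Rightarrow> bool" where
  "monogenic m n Ups us k e \<Omega> \<Phi> \<longleftrightarrow>
     continuous_on \<Omega> \<Phi> \<and> (\<forall>\<zeta>\<in>\<Omega>. \<Phi> \<zeta> \<in> Alg n) \<and>
     (\<forall>\<zeta>\<in>\<Omega>. \<exists>d\<in>Alg n. \<forall>h\<in>Ek k e.
        ((\<lambda>\<epsilon>. vscale (1 / \<epsilon>) (vsub (\<Phi> (vadd \<zeta> (vscale \<epsilon> h))) (\<Phi> \<zeta>)))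
           \<longlongrightarrow> amul m n Ups us h d) (at_right 0))"

end

theory Submission
  imports Defs
begin

text \<open>
  Write \<open>u\<close> for the block of an index \<open>q\<close>, i.e. \<open>I\<^sub>u I\<^sub>q = I\<^sub>q\<close>. No complex analysis is needed.
  Along a direction in \<open>M\<^sub>u\<close>, the component \<open>\<Phi>\<^sub>q\<close> is a polynomial of degree at most \<open>q\<close> in the
  real parameter: its derivative is a linear combination of the components \<open>\<Phi>'\<^sub>s\<close> with \<open>s < q\<close> in
  the same block, and \<open>\<Phi>'\<^sub>s\<close>, being the derivative in direction \<open>e\<^sub>1 = 1\<close>, is a limit of difference
  quotients of \<open>\<Phi>\<^sub>s\<close>, hence polynomial by induction. So \<open>\<Phi>\<^sub>q\<close> extends along the fibres of \<open>f\<^sub>u\<close> by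
  Lagrange extrapolation. Convexity makes the result independent of the base point in the fibre,
  and locally the extension is a fixed linear combination of translates of \<open>\<Phi>\<close>, so it inherits
  continuity and monogenicity.
\<close>

subsection \<open>Polynomials on the unit interval\<close>

text \<open>Only the unit interval is constrained: convexity keeps the segment between two points of
  \<open>\<Omega>\<close> inside \<open>\<Omega>\<close> and says nothing beyond its ends.\<close>

definition poly_on_unit :: "nat \<Rightarrow> (real \<Rightarrow> complex) \<Rightarrow> bool" where
  "poly_on_unit N f \<longleftrightarrow>
     (\<exists>p::complex poly. degree p \<le> N \<and> (\<forall>t\<in>{0..1}. f t = poly p (of_real t)))"

text \<open>The Lagrange basis polynomial for the equidistant nodes \<open>j / N\<close>,
  \<open>j = 0..N\<close>.\<close>

definition lagrange :: "nat \<Rightarrow> nat \<Rightarrow> complex poly" where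
  "lagrange N i = (\<Prod>j\<in>{..N} - {i}. smult (of_nat N / (of_nat i - of_nat j)) [:- (of_nat j / of_nat N), 1:])"

text \<open>The value at \<open>z\<close> of the interpolation polynomial of \<open>f\<close>. Being
  a finite linear combination of values of \<open>f\<close>, it commutes with limits, sums and
  derivatives in a parameter.\<close>

definition extrapolate :: "nat \<Rightarrow> (real \<Rightarrow> complex) \<Rightarrow> complex \<Rightarrow> complex" where
  "extrapolate N f z = (\<Sum>i\<le>N. poly (lagrange N i) z * f (real i / real N))"

lemma degree_lagrange: "i \<le> N \<Longrightarrow> degree (lagrange N i) \<le> N"
proof -
  assume "i \<le> N"
  have "degree (lagrange N i) \<le> (\<Sum>j\<in>{..N} - {i}. 1)"
    unfolding lagrange_def
    by (rule order_trans[OF degree_prod_sum_le[OF finite_Diff[OF finite_atMost]] sum_mono], unfold o_def,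
        rule order_trans[OF degree_smult_le]) simp
  with \<open>i \<le> N\<close> show ?thesis by simp
qed

lemma poly_lagrange_node:
  assumes "i \<le> N" "l \<le> N" "N > 0"
  shows "poly (lagrange N i) (of_nat l / of_nat N) = (if l = i then 1 else 0)"
proof (cases "l = i")
  case True
  have "poly (smult (of_nat N / (of_nat i - of_nat j)) [:- (of_nat j / of_nat N), 1:]) (of_nat i / of_nat N) = (1::complex)"
    if "j \<noteq> i" for j
    using that \<open>N > 0\<close> by (simp add: field_simps flip: diff_divide_distrib)
  then have "poly (lagrange N i) (of_nat i / of_nat N) = (\<Prod>j\<in>{..N} - {i}. 1)"
    unfolding lagrange_def poly_prod by (intro prod.cong refl) blast
  then show ?thesis using True by simp
next
  case False
  then show ?thesis using assms unfolding lagrange_def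
    by (auto simp: poly_prod intro!: bexI[of _ l])
qed

text \<open>Two polynomials of degree at most \<open>N\<close> that agree at \<open>N + 1\<close>
  points are equal; \<open>N > 0\<close> makes the nodes distinct.\<close>

lemma extrapolate_poly:
  assumes p: "degree p \<le> N" and N: "N > 0"
    and f: "\<And>t. t \<in> {0..1} \<Longrightarrow> f t = poly p (of_real t)"
  shows "extrapolate N f z = poly p z"
proof -
  let ?q = "\<Sum>i\<le>N. smult (f (real i / real N)) (lagrange N i)"
  have "p = ?q"
  proof (rule poly_eqI_degree)
    let ?A = "(\<lambda>l. of_nat l / of_nat N :: complex) ` {..N}"
    have card: "card ?A = Suc N"
      using N by (subst card_image) (auto simp: inj_on_def)
    show "card ?A > degree p" using card p by simp
    have "degree ?q \<le> N"
      by (rule degree_sum_le) (auto intro: order_trans[OF degree_smult_le] degree_lagrange)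
    then show "card ?A > degree ?q" using card by simp
    fix x assume "x \<in> ?A"
    then obtain l where l: "l \<le> N" "x = of_nat l / of_nat N" by auto
    have "poly ?q x = (\<Sum>i\<le>N. if l = i then f (real i / real N) else 0)"
      unfolding poly_sum using l N by (intro sum.cong) (auto simp: poly_lagrange_node)
    also have "\<dots> = f (real l / real N)" using l by simp
    also have "\<dots> = poly p x" using l N by (subst f) auto
    finally show "poly p x = poly ?q x" by simp
  qed
  then have "poly p z = poly ?q z" by simp
  then show ?thesis by (simp add: extrapolate_def poly_sum mult.commute)
qed

lemma extrapolate_difference_quotient:
  "extrapolate N (\<lambda>t. (f t - g t) /\<^sub>R c) z = of_real (1 / c) * (extrapolate N f z - extrapolate N g z)"
  unfolding extrapolate_def sum_subtractf[symmetric] sum_distrib_left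
  by (intro sum.cong refl) (simp add: scaleR_conv_of_real field_simps)

section \<open>Closure properties of functions that are polynomial on the unit interval\<close>

lemma poly_on_unit_mono: "poly_on_unit N f \<Longrightarrow> N \<le> M \<Longrightarrow> poly_on_unit M f"
  unfolding poly_on_unit_def by (meson order_trans)

lemma poly_on_unit_const: "poly_on_unit N (\<lambda>t. c)"
  unfolding poly_on_unit_def by (intro exI[of _ "[:c:]"]) auto

lemma poly_on_unit_cmult:
  assumes "poly_on_unit N f" shows "poly_on_unit N (\<lambda>t. c * f t)"
proof -
  obtain p where "degree p \<le> N" "\<forall>t\<in>{0..1}. f t = poly p (of_real t)"
    using assms poly_on_unit_def by blast
  then show ?thesis unfolding poly_on_unit_def
    by (intro exI[of _ "smult c p"]) (auto intro: order_trans[OF degree_smult_le])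
qed

lemma poly_on_unit_add:
  assumes "poly_on_unit N f" "poly_on_unit N g" shows "poly_on_unit N (\<lambda>t. f t + g t)"
proof -
  obtain p q where "degree p \<le> N" "\<forall>t\<in>{0..1}. f t = poly p (of_real t)"
    "degree q \<le> N" "\<forall>t\<in>{0..1}. g t = poly q (of_real t)"
    using assms poly_on_unit_def by metis
  then show ?thesis unfolding poly_on_unit_def
    by (intro exI[of _ "p + q"]) (auto intro: degree_add_le)
qed

lemma poly_on_unit_sum:
  assumes "\<And>i. i \<in> S \<Longrightarrow> poly_on_unit N (f i)"
  shows "poly_on_unit N (\<lambda>t. \<Sum>i\<in>S. f i t)"
  using assms
  by (induction S rule: infinite_finite_induct) (auto intro: poly_on_unit_const poly_on_unit_add)

text \<open>Each \<open>f \<epsilon>\<close> is recovered from its values at the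
  \<open>N + 1\<close> nodes, so pointwise convergence there already forces the limit to be its own
  interpolation polynomial.\<close>

lemma poly_on_unit_limit:
  assumes N: "N > 0" and F: "F \<noteq> bot"
    and f: "eventually (\<lambda>\<epsilon>. poly_on_unit N (f \<epsilon>)) F"
    and lim: "\<And>t. t \<in> {0..1} \<Longrightarrow> ((\<lambda>\<epsilon>. f \<epsilon> t) \<longlongrightarrow> g t) F"
  shows "poly_on_unit N g"
proof -
  define p where "p = (\<Sum>i\<le>N. smult (g (real i / real N)) (lagrange N i))"
  have "degree p \<le> N" unfolding p_def
    by (rule degree_sum_le) (auto intro: order_trans[OF degree_smult_le] degree_lagrange)
  moreover have "g t = poly p (of_real t)" if t: "t \<in> {0..1}" for t
  proof -
    have "((\<lambda>\<epsilon>. extrapolate N (f \<epsilon>) (of_real t)) \<longlongrightarrow> extrapolate N g (of_real t)) F"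
      unfolding extrapolate_def using N
      by (intro tendsto_sum tendsto_mult tendsto_const lim) auto
    moreover have "eventually (\<lambda>\<epsilon>. extrapolate N (f \<epsilon>) (of_real t) = f \<epsilon> t) F"
      using f
    proof eventually_elim
      case (elim \<epsilon>)
      then obtain q where "degree q \<le> N" "\<forall>t\<in>{0..1}. f \<epsilon> t = poly q (of_real t)"
        unfolding poly_on_unit_def by blast
      then show ?case using N t by (subst extrapolate_poly[of q]) auto
    qed
    ultimately have "((\<lambda>\<epsilon>. f \<epsilon> t) \<longlongrightarrow> extrapolate N g (of_real t)) F"
      by (rule Lim_transform_eventually)
    then have "g t = extrapolate N g (of_real t)"
      using lim[OF t] F tendsto_unique by blast
    then show ?thesis by (simp add: p_def extrapolate_def poly_sum mult.commute)
  qed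
  ultimately show ?thesis unfolding poly_on_unit_def by blast
qed

lemma poly_antiderivative:
  fixes p :: "complex poly"
  obtains P where "pderiv P = p" "degree P \<le> Suc (degree p)"
proof -
  define P where "P = (\<Sum>i\<le>degree p. monom (coeff p i / of_nat (Suc i)) (Suc i))"
  have "pderiv P = (\<Sum>i\<le>degree p. pderiv (monom (coeff p i / of_nat (Suc i)) (Suc i)))"
    \<comment> \<open>The sum rule for \<open>pderiv\<close> is taken as the first-order case of the
      rule for iterated derivatives.\<close>
    using higher_pderiv_sum[of 1] unfolding P_def by simp
  also have "\<dots> = (\<Sum>i\<le>degree p. monom (coeff p i) i)"
    by (intro sum.cong refl) (simp add: pderiv_monom del: of_nat_Suc)
  finally have "pderiv P = (\<Sum>i\<le>degree p. monom (coeff p i) i)" .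
  then have "pderiv P = p" by (simp add: poly_as_sum_of_monoms)
  moreover have "degree P \<le> Suc (degree p)" unfolding P_def
    by (rule degree_sum_le) (auto intro: order_trans[OF degree_monom_le])
  ultimately show ?thesis using that by blast
qed

text \<open>Subtracting a polynomial antiderivative of \<open>g\<close> leaves a function with zero
  derivative, hence a constant.\<close>

lemma poly_on_unit_antiderivative:
  assumes f: "\<And>t. t \<in> {0..1} \<Longrightarrow> (f has_vector_derivative g t) (at t)"
    and g: "poly_on_unit N g"
  shows "poly_on_unit (Suc N) f"
proof -
  obtain p where p: "degree p \<le> N" "\<And>t. t \<in> {0..1} \<Longrightarrow> g t = poly p (of_real t)"
    using g poly_on_unit_def by metis
  obtain P where P: "pderiv P = p" "degree P \<le> Suc (degree p)" using poly_antiderivative .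
  have "((\<lambda>t. f t - poly P (of_real t)) has_vector_derivative 0) (at t within {0..1})"
    if t: "t \<in> {0..1}" for t
  proof -
    have "((\<lambda>t. poly P (of_real t)) has_vector_derivative poly p (of_real t)) (at t)"
      using has_vector_derivative_real_field[OF poly_DERIV[of P "of_real t"]] P by simp
    from has_vector_derivative_diff[OF f[OF t] this] show ?thesis
      using p(2)[OF t] by (simp add: has_vector_derivative_at_within)
  qed
  then obtain c where c: "\<And>t. t \<in> {0..1} \<Longrightarrow> f t - poly P (of_real t) = c"
    using has_vector_derivative_zero_constant[OF convex_real_interval(5)] by blast
  have "f t = poly ([:c:] + P) (of_real t)" if "t \<in> {0..1}" for t
    using c[OF that] by (simp add: algebra_simps)
  moreover have "degree ([:c:] + P) \<le> Suc N"
    using P p by (intro degree_add_le) auto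
  ultimately show ?thesis unfolding poly_on_unit_def by blast
qed

section \<open>Two-sided derivatives and componentwise limits\<close>

text \<open>Monogenicity speaks only of limits as \<open>\<epsilon>\<close> tends to 0 from the
  right; the directions \<open>h\<close> and \<open>- h\<close> together provide the two hypotheses
  here.\<close>

lemma has_vector_derivativeI_two_sided:
  fixes g :: "real \<Rightarrow> 'a::real_normed_vector"
  assumes "((\<lambda>\<epsilon>. (g (t + \<epsilon>) - g t) /\<^sub>R \<epsilon>) \<longlongrightarrow> c) (at_right 0)"
    and "((\<lambda>\<epsilon>. (g (t - \<epsilon>) - g t) /\<^sub>R \<epsilon>) \<longlongrightarrow> - c) (at_right 0)"
  shows "(g has_vector_derivative c) (at t)"
proof -
  have "((\<lambda>\<epsilon>. (g (t + \<epsilon>) - g t) /\<^sub>R \<epsilon>) \<longlongrightarrow> c) (at_left 0)"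
    using tendsto_minus[OF assms(2)] by (simp add: filterlim_at_left_to_right)
  then have "((\<lambda>\<epsilon>. (g (t + \<epsilon>) - g t) /\<^sub>R \<epsilon>) \<longlongrightarrow> c) (at 0)"
    using assms(1) by (rule filterlim_split_at)
  then have l: "((\<lambda>x. (g x - g t) /\<^sub>R (x - t)) \<longlongrightarrow> c) (at t)"
    by (subst filterlim_at_to_0) (simp add: add.commute)
  have "((\<lambda>x. norm ((g x - g t) /\<^sub>R (x - t) - c)) \<longlongrightarrow> 0) (at t)"
    using l by (simp add: tendsto_norm_zero_iff LIM_zero_iff)
  \<comment> \<open>Dividing by \<open>x - t\<close> and by \<open>norm (x - t)\<close> differs only
    in sign, which disappears under the norm.\<close>
  moreover have "eventually (\<lambda>x. norm ((g x - g t) /\<^sub>R (x - t) - c)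
      = norm (((g x - g t) - (x - t) *\<^sub>R c) /\<^sub>R norm (x - t))) (at t)"
    unfolding eventually_at_filter
  proof (intro always_eventually allI impI)
    fix x assume "x \<noteq> t"
    then have "(g x - g t) /\<^sub>R (x - t) - c = ((g x - g t) - (x - t) *\<^sub>R c) /\<^sub>R (x - t)"
      by (simp add: scaleR_diff_right)
    then show "norm ((g x - g t) /\<^sub>R (x - t) - c)
        = norm (((g x - g t) - (x - t) *\<^sub>R c) /\<^sub>R norm (x - t))"
      by simp
  qed
  ultimately have "((\<lambda>x. norm (((g x - g t) - (x - t) *\<^sub>R c) /\<^sub>R norm (x - t))) \<longlongrightarrow> 0) (at t)"
    by (rule Lim_transform_eventually)
  then have "((\<lambda>x. ((g x - g t) - (x - t) *\<^sub>R c) /\<^sub>R norm (x - t)) \<longlongrightarrow> 0) (at t)"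
    by (rule tendsto_norm_zero_cancel)
  then show ?thesis
    unfolding has_vector_derivative_def has_derivative_at_within
    by (simp add: bounded_linear_scaleR_left)
qed

lemma tendsto_funI:
  fixes f :: "'a \<Rightarrow> 'b \<Rightarrow> 'c::topological_space"
  assumes "\<And>i. ((\<lambda>x. f x i) \<longlongrightarrow> l i) F"
  shows "(f \<longlongrightarrow> l) F"
  using assms limitin_componentwise[of "\<lambda>_. euclidean" UNIV f l F]
  by (simp add: euclidean_product_topology limitin_canonical_iff)

lemma tendsto_fun_component:
  fixes f :: "'a \<Rightarrow> 'b \<Rightarrow> 'c::topological_space"
  assumes "(f \<longlongrightarrow> l) F"
  shows "((\<lambda>x. f x i) \<longlongrightarrow> l i) F"
  using assms limitin_componentwise[of "\<lambda>_. euclidean" UNIV f l F]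
  by (simp add: euclidean_product_topology limitin_canonical_iff)

subsection \<open>Rays and the real span\<close>

lemmas vec_defs = vadd_def vsub_def vscale_def

definition ray :: "(nat \<Rightarrow> complex) \<Rightarrow> (nat \<Rightarrow> complex) \<Rightarrow> real \<Rightarrow> nat \<Rightarrow> complex" where
  "ray z h t = vadd z (vscale t h)"

lemma ray_0 [simp]: "ray z h 0 = z"
  by (simp add: ray_def vec_defs)

lemma ray_1 [simp]: "ray z h 1 = vadd z h"
  by (simp add: ray_def vec_defs)

lemma ray_add: "ray z h (s + t) = ray (ray z h s) h t"
  by (simp add: ray_def vec_defs algebra_simps)

lemma ray_diff: "ray z h (s - t) = ray (ray z h s) (vscale (- 1) h) t"
  by (simp add: ray_def vec_defs algebra_simps)

lemma ray_vscale: "ray z (vscale c h) t = ray z h (c * t)"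
  by (simp add: ray_def vec_defs algebra_simps)

lemma ray_vadd: "ray (vadd z w) h t = vadd (ray z h t) w"
  by (simp add: ray_def vec_defs algebra_simps)

lemma tendsto_ray:
  assumes "(c \<longlongrightarrow> t) F"
  shows "((\<lambda>x. ray z h (c x)) \<longlongrightarrow> ray z h t) F"
  unfolding ray_def vec_defs
  by (intro tendsto_funI tendsto_intros assms)

lemma Ek_vadd: assumes "a \<in> Ek k e" "b \<in> Ek k e" shows "vadd a b \<in> Ek k e"
proof -
  obtain x y where "a = (\<lambda>p. \<Sum>j\<in>{1..k}. complex_of_real (x j) * e j p)"
    "b = (\<lambda>p. \<Sum>j\<in>{1..k}. complex_of_real (y j) * e j p)"
    using assms unfolding Ek_def by blast
  then show ?thesis unfolding Ek_def vadd_def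
    by (intro CollectI exI[of _ "\<lambda>j. x j + y j"]) (simp add: sum.distrib distrib_right)
qed

lemma Ek_vscale: assumes "a \<in> Ek k e" shows "vscale c a \<in> Ek k e"
proof -
  obtain x where "a = (\<lambda>p. \<Sum>j\<in>{1..k}. complex_of_real (x j) * e j p)"
    using assms unfolding Ek_def by blast
  then show ?thesis unfolding Ek_def vscale_def
    by (intro CollectI exI[of _ "\<lambda>j. c * x j"]) (simp add: sum_distrib_left mult.assoc)
qed

lemma Ek_vsub: assumes "a \<in> Ek k e" "b \<in> Ek k e" shows "vsub a b \<in> Ek k e"
proof -
  have "vsub a b = vadd a (vscale (-1) b)" by (simp add: vec_defs)
  then show ?thesis using assms by (simp add: Ek_vadd Ek_vscale)
qed

lemma Ek_ray: "a \<in> Ek k e \<Longrightarrow> h \<in> Ek k e \<Longrightarrow> ray a h t \<in> Ek k e"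
  by (simp add: ray_def Ek_vadd Ek_vscale)

lemma Ek_generator: assumes "j \<in> {1..k}" shows "e j \<in> Ek k e"
proof -
  have "e j p = (\<Sum>i\<in>{1..k}. complex_of_real (if i = j then 1 else 0) * e i p)" for p
    using assms by (simp add: if_distrib[of complex_of_real] if_distrib[of "\<lambda>x. x * _"] cong: if_cong)
  then show ?thesis unfolding Ek_def by (intro CollectI exI[of _ "\<lambda>i. if i = j then 1 else 0"]) auto
qed

subsection \<open>The algebra and its blocks\<close>

text \<open>The index \<open>u\<close> of the idempotent \<open>I\<^sub>u\<close> with \<open>I\<^sub>u I\<^sub>q = I\<^sub>q\<close>.\<close>

definition block :: "nat \<Rightarrow> (nat \<Rightarrow> nat) \<Rightarrow> nat \<Rightarrow> nat" where
  "block m us q = (if q \<le> m then q else us q)"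

text \<open>The matrix of multiplication by \<open>h\<close> in the basis: it gives the weight of
  component \<open>s\<close> of the other factor in component \<open>q\<close> of the
  product.\<close>

definition mult_coeff ::
  "nat \<Rightarrow> nat \<Rightarrow> (nat \<Rightarrow> nat \<Rightarrow> nat \<Rightarrow> complex) \<Rightarrow> (nat \<Rightarrow> nat) \<Rightarrow> (nat \<Rightarrow> complex) \<Rightarrow> nat \<Rightarrow> nat \<Rightarrow> complex"
where
  "mult_coeff m n Ups us h s q = (\<Sum>r\<in>{1..n}. h r * bprod m n Ups us r s q)"

lemma amul_eq_mult_coeff:
  "amul m n Ups us h a q = (\<Sum>s\<in>{1..n}. mult_coeff m n Ups us h s q * a s)"
  unfolding amul_def mult_coeff_def
  by (subst sum.swap) (simp add: sum_distrib_left sum_distrib_right mult_ac)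

lemma amul_outside: "q \<notin> {1..n} \<Longrightarrow> m \<le> n \<Longrightarrow> amul m n Ups us a b q = 0"
  unfolding amul_def by (intro sum.neutral ballI) (auto simp: bprod_def basisI_def)

lemma amul_vscale_left: "amul m n Ups us (vscale c h) a q = of_real c * amul m n Ups us h a q"
  unfolding amul_def vscale_def by (simp add: sum_distrib_left mult_ac)

text \<open>In terms of \<open>block\<close>, the products of an idempotent with idempotents and
  with the remaining basis elements obey a single rule.\<close>

lemma bprod_idempotent:
  assumes "r \<le> m"
  shows "bprod m n Ups us r s = (if block m us s = r then basisI s else (\<lambda>_. 0))"
  using assms by (auto simp: bprod_def block_def)

lemma amul_basisI_left:
  assumes "r \<in> {1..n}"
  shows "amul m n Ups us (basisI r) a q = (\<Sum>s\<in>{1..n}. a s * bprod m n Ups us r s q)"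
proof -
  have "amul m n Ups us (basisI r) a q =
      (\<Sum>r'\<in>{1..n}. if r' = r then (\<Sum>s\<in>{1..n}. a s * bprod m n Ups us r s q) else 0)"
    unfolding amul_def by (intro sum.cong) (auto simp: basisI_def)
  then show ?thesis using assms by simp
qed

lemma amul_basisI:
  assumes "r \<in> {1..n}" "s \<in> {1..n}"
  shows "amul m n Ups us (basisI r) (basisI s) = bprod m n Ups us r s"
proof
  fix q
  have "amul m n Ups us (basisI r) (basisI s) q =
      (\<Sum>s'\<in>{1..n}. if s' = s then bprod m n Ups us r s q else 0)"
    unfolding amul_basisI_left[OF assms(1)] by (intro sum.cong) (auto simp: basisI_def)
  then show "amul m n Ups us (basisI r) (basisI s) q = bprod m n Ups us r s q"
    using assms by simp
qed

text \<open>Multiplication by \<open>I\<^sub>u\<close> is the projection onto block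
  \<open>u\<close>.\<close>

lemma amul_idempotent:
  assumes "u \<in> {1..m}" "m \<le> n" "q \<in> {1..n}"
  shows "amul m n Ups us (basisI u) a q = (if block m us q = u then a q else 0)"
proof -
  have "amul m n Ups us (basisI u) a q =
      (\<Sum>s\<in>{1..n}. if s = q then (if block m us q = u then a q else 0) else 0)"
  proof (subst amul_basisI_left)
    show "u \<in> {1..n}" using assms by simp
    show "(\<Sum>s\<in>{1..n}. a s * bprod m n Ups us u s q) =
      (\<Sum>s\<in>{1..n}. if s = q then (if block m us q = u then a q else 0) else 0)"
      using assms by (intro sum.cong) (auto simp: bprod_idempotent basisI_def)
  qed
  then show ?thesis using assms by simp
qed

lemma basisI_Alg: "r \<in> {1..n} \<Longrightarrow> basisI r \<in> Alg n"
  by (auto simp: Alg_def basisI_def)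

context
  fixes m n :: nat and Ups :: "nat \<Rightarrow> nat \<Rightarrow> nat \<Rightarrow> complex" and us :: "nat \<Rightarrow> nat"
  assumes alg: "is_Anm m n Ups us"
begin

lemma Anm_dims: "1 \<le> m" "m \<le> n"
  using alg by (auto simp: is_Anm_def)

lemma block_range: "q \<in> {1..n} \<Longrightarrow> block m us q \<in> {1..m}"
  using alg by (auto simp: is_Anm_def block_def)

lemma amul_unit:
  assumes "q \<in> {1..n}"
  shows "amul m n Ups us (unitA m) a q = a q"
proof -
  have "amul m n Ups us (unitA m) a q =
      (\<Sum>s\<in>{1..n}. \<Sum>r\<in>{1..n}. if r = block m us s then (if s = q then a q else 0) else 0)"
    unfolding amul_def
    by (subst sum.swap) (use block_range in \<open>intro sum.cong refl,
        auto simp: unitA_def bprod_idempotent basisI_def\<close>)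
  also have "\<dots> = (\<Sum>s\<in>{1..n}. if s = q then a q else 0)"
    using block_range Anm_dims by (intro sum.cong) force+
  finally show ?thesis using assms by simp
qed

text \<open>Compare the \<open>q\<close>-th components of \<open>I\<^sub>u (I\<^sub>s I\<^sub>r) = (I\<^sub>u I\<^sub>s) I\<^sub>r\<close>, where \<open>u\<close> is the block of \<open>q\<close>.\<close>

lemma bprod_block:
  assumes rs: "r \<in> {1..n}" "s \<in> {1..n}" "q \<in> {1..n}" and nz: "bprod m n Ups us r s q \<noteq> 0"
  shows "block m us s = block m us q"
proof (rule ccontr)
  assume neq: "block m us s \<noteq> block m us q"
  let ?mul = "amul m n Ups us" and ?u = "block m us q"
  have u: "?u \<in> {1..m}" "?u \<in> {1..n}" using block_range[OF rs(3)] Anm_dims by auto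
  have comm: "?mul (basisI s) (basisI r) = ?mul (basisI r) (basisI s)"
    using alg rs basisI_Alg unfolding is_Anm_def by blast
  have "bprod m n Ups us r s q = ?mul (basisI ?u) (?mul (basisI s) (basisI r)) q"
    using amul_idempotent[OF u(1) Anm_dims(2) rs(3)] comm amul_basisI[OF rs(1,2)] by simp
  also have "?mul (basisI ?u) (?mul (basisI s) (basisI r)) = ?mul (?mul (basisI ?u) (basisI s)) (basisI r)"
    using alg rs u basisI_Alg unfolding is_Anm_def by metis
  also have "?mul (basisI ?u) (basisI s) = (\<lambda>_. 0)"
    using u rs neq by (simp add: amul_basisI bprod_idempotent)
  finally show False using nz by (simp add: amul_def)
qed

text \<open>Multiplication by any \<open>h\<close> is thus block diagonal, so different blocks can
  be treated independently.\<close>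

lemma mult_coeff_block:
  assumes "s \<in> {1..n}" "q \<in> {1..n}" "mult_coeff m n Ups us h s q \<noteq> 0"
  shows "block m us s = block m us q"
proof -
  obtain r where "r \<in> {1..n}" "bprod m n Ups us r s q \<noteq> 0"
    using assms(3) unfolding mult_coeff_def by (fastforce elim: sum.not_neutral_contains_not_neutral)
  then show ?thesis using bprod_block assms by blast
qed

text \<open>A diagonal entry can come only from the idempotent of the block, whose coefficient in
  \<open>h\<close> is zero; every other product contributing to \<open>q\<close> raises the index.
  This strict triangularity drives the induction over components.\<close>

lemma mult_coeff_less:
  assumes "s \<in> {1..n}" "q \<in> {1..n}" "h (block m us q) = 0" "mult_coeff m n Ups us h s q \<noteq> 0"
  shows "s < q"
proof -
  obtain r where r: "r \<in> {1..n}" "h r \<noteq> 0" "bprod m n Ups us r s q \<noteq> 0"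
    using assms(4) unfolding mult_coeff_def by (fastforce elim: sum.not_neutral_contains_not_neutral)
  with assms(3) have "r \<noteq> block m us q" by metis
  with r show ?thesis by (auto simp: bprod_def block_def basisI_def split: if_splits)
qed

end

subsection \<open>Monogenic functions along the fibres\<close>

text \<open>The derivative is fixed as a function \<open>d\<close>, so that its behaviour along rays
  can be described.\<close>

locale monogenic_function =
  fixes m n k :: nat and Ups :: "nat \<Rightarrow> nat \<Rightarrow> nat \<Rightarrow> complex" and us :: "nat \<Rightarrow> nat"
    and e :: "nat \<Rightarrow> nat \<Rightarrow> complex" and \<Omega> :: "(nat \<Rightarrow> complex) set"
    and \<Phi> d :: "(nat \<Rightarrow> complex) \<Rightarrow> (nat \<Rightarrow> complex)"
  assumes alg: "is_Anm m n Ups us"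
    and unit: "e 1 = unitA m" "1 \<le> k"
    and dom: "\<Omega> \<subseteq> Ek k e" "openin (top_of_set (Ek k e)) \<Omega>"
    and conv: "\<And>u. u \<in> {1..m} \<Longrightarrow> convex_wrt (Mdir k e u) \<Omega>"
    and cont: "continuous_on \<Omega> \<Phi>"
    and deriv: "\<And>z h. z \<in> \<Omega> \<Longrightarrow> h \<in> Ek k e \<Longrightarrow>
      ((\<lambda>\<epsilon>. vscale (1 / \<epsilon>) (vsub (\<Phi> (vadd z (vscale \<epsilon> h))) (\<Phi> z)))
         \<longlongrightarrow> amul m n Ups us h (d z)) (at_right 0)"
begin

abbreviation mul where "mul \<equiv> amul m n Ups us"

abbreviation blk where "blk \<equiv> block m us"

lemma blk_range: "q \<in> {1..n} \<Longrightarrow> blk q \<in> {1..m}"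
  using block_range[OF alg] .

lemma deriv_component:
  assumes "z \<in> \<Omega>" "h \<in> Ek k e"
  shows "((\<lambda>\<epsilon>. (\<Phi> (ray z h \<epsilon>) q - \<Phi> z q) /\<^sub>R \<epsilon>) \<longlongrightarrow> mul h (d z) q) (at_right 0)"
  using tendsto_fun_component[OF deriv[OF assms], of q]
  by (simp add: vscale_def vsub_def ray_def vadd_def scaleR_conv_of_real inverse_eq_divide)

text \<open>\<open>\<Omega>\<close> is open only relative to \<open>Ek k e\<close>, hence the extra
  condition on the values of \<open>g\<close>.\<close>

lemma eventually_in_domain:
  assumes "(g \<longlongrightarrow> z) F" "z \<in> \<Omega>" "eventually (\<lambda>x. g x \<in> Ek k e) F"
  shows "eventually (\<lambda>x. g x \<in> \<Omega>) F"
proof -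
  obtain T where T: "open T" "\<Omega> = Ek k e \<inter> T"
    using dom(2) by (metis openin_open)
  have "eventually (\<lambda>x. g x \<in> T) F"
    using assms T by (intro topological_tendstoD) auto
  with assms(3) show ?thesis by eventually_elim (simp add: T)
qed

lemma ray_in_domain:
  assumes "z \<in> \<Omega>" "ray z h c \<in> \<Omega>" "h \<in> Ek k e" "h u = 0" "u \<in> {1..m}" "0 \<le> t" "t \<le> c"
  shows "ray z h t \<in> \<Omega>"
proof (cases "c = 0")
  case True
  with assms show ?thesis by simp
next
  case False
  have eq: "vsub (ray z h c) z = vscale c h" by (simp add: ray_def vec_defs)
  have "vscale c h \<in> Mdir k e u"
    using assms by (simp add: Mdir_def Ek_vscale) (simp add: vscale_def)
  moreover have "t / c \<in> {0..1}" using assms False by (auto simp: divide_simps)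
  ultimately have "vadd z (vscale (t / c) (vscale c h)) \<in> \<Omega>"
    using conv[OF assms(5)] assms(1,2) unfolding convex_wrt_def by (metis eq)
  moreover have "vadd z (vscale (t / c) (vscale c h)) = ray z h t"
    using False by (simp add: ray_def vec_defs fun_eq_iff)
  ultimately show ?thesis by simp
qed

text \<open>The left difference quotient at \<open>t\<close> is the right one in direction
  \<open>- h\<close>, and multiplication is real homogeneous in \<open>h\<close>.\<close>

lemma deriv_along_ray:
  assumes "ray z h t \<in> \<Omega>" "h \<in> Ek k e"
  shows "((\<lambda>t. \<Phi> (ray z h t) q) has_vector_derivative mul h (d (ray z h t)) q) (at t)"
proof (rule has_vector_derivativeI_two_sided)
  show "((\<lambda>\<epsilon>. (\<Phi> (ray z h (t + \<epsilon>)) q - \<Phi> (ray z h t) q) /\<^sub>R \<epsilon>)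
      \<longlongrightarrow> mul h (d (ray z h t)) q) (at_right 0)"
    unfolding ray_add by (rule deriv_component[OF assms])
  have "((\<lambda>\<epsilon>. (\<Phi> (ray z h (t - \<epsilon>)) q - \<Phi> (ray z h t) q) /\<^sub>R \<epsilon>)
      \<longlongrightarrow> mul (vscale (- 1) h) (d (ray z h t)) q) (at_right 0)"
    unfolding ray_diff by (rule deriv_component[OF assms(1) Ek_vscale[OF assms(2)]])
  then show "((\<lambda>\<epsilon>. (\<Phi> (ray z h (t - \<epsilon>)) q - \<Phi> (ray z h t) q) /\<^sub>R \<epsilon>)
      \<longlongrightarrow> - mul h (d (ray z h t)) q) (at_right 0)"
    by (simp add: amul_vscale_left)
qed

text \<open>Since \<open>e\<^sub>1\<close> is the unit, \<open>d\<close> is the derivative in direction \<open>e\<^sub>1\<close>, hence a pointwise limit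
  of difference quotients, each of which is polynomial of degree at most \<open>q\<close> along the ray.\<close>

lemma derivative_polynomial:
  assumes q: "q \<in> {1..n}"
    and poly: "\<And>z h. z \<in> \<Omega> \<Longrightarrow> vadd z h \<in> \<Omega> \<Longrightarrow> h \<in> Mdir k e (blk q) \<Longrightarrow>
      poly_on_unit q (\<lambda>t. \<Phi> (ray z h t) q)"
    and zh: "z \<in> \<Omega>" "vadd z h \<in> \<Omega>" "h \<in> Mdir k e (blk q)"
  shows "poly_on_unit q (\<lambda>t. d (ray z h t) q)"
proof (rule poly_on_unit_limit)
  let ?e = "e 1"
  have e1: "?e \<in> Ek k e" using unit by (intro Ek_generator) simp
  \<comment> \<open>By openness both end points of the segment stay in \<open>\<Omega>\<close> under
    a small shift along \<open>e 1\<close>, so \<open>poly\<close> applies to the shifted segment as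
    well.\<close>
  have ev: "eventually (\<lambda>\<epsilon>. ray w ?e \<epsilon> \<in> \<Omega>) (at_right 0)" if "w \<in> \<Omega>" for w
    using that dom e1
    by (intro eventually_in_domain[of _ w])
       (auto intro!: Ek_ray always_eventually tendsto_eq_rhs[OF tendsto_ray[of _ 0]] tendsto_ident_at)
  show "eventually (\<lambda>\<epsilon>. poly_on_unit q
      (\<lambda>t. inverse (of_real \<epsilon>) * (\<Phi> (ray (ray z ?e \<epsilon>) h t) q + (- 1) * \<Phi> (ray z h t) q))) (at_right 0)"
    using ev[OF zh(1)] ev[OF zh(2)]
  proof eventually_elim
    case (elim \<epsilon>)
    have "vadd (ray z ?e \<epsilon>) h = ray (vadd z h) ?e \<epsilon>" by (simp add: ray_vadd)
    with elim show ?case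
      by (intro poly_on_unit_cmult poly_on_unit_add poly zh) auto
  qed
  fix t :: real assume t: "t \<in> {0..1}"
  have "ray z h t \<in> \<Omega>"
    using zh t blk_range[OF q] by - (rule ray_in_domain[of z h 1 "blk q"], auto simp: Mdir_def)
  from deriv_component[OF this e1, of q]
  have "((\<lambda>\<epsilon>. (\<Phi> (ray (ray z h t) ?e \<epsilon>) q - \<Phi> (ray z h t) q) /\<^sub>R \<epsilon>) \<longlongrightarrow> d (ray z h t) q) (at_right 0)"
    using unit amul_unit[OF alg q] by simp
  moreover have "ray (ray z h t) ?e \<epsilon> = ray (ray z ?e \<epsilon>) h t" for \<epsilon>
    by (simp add: ray_def vec_defs algebra_simps)
  ultimately show "((\<lambda>\<epsilon>. inverse (of_real \<epsilon>) * (\<Phi> (ray (ray z ?e \<epsilon>) h t) q + (- 1) * \<Phi> (ray z h t) q))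
      \<longlongrightarrow> d (ray z h t) q) (at_right 0)"
    by (simp add: scaleR_conv_of_real)
qed (use q in auto)

text \<open>Strong induction on \<open>q\<close>: the derivative along the ray involves only
  \<open>d\<close> at indices \<open>s < q\<close> of the same block, hence has degree at most
  \<open>q - 1\<close>, and integration raises this bound to \<open>q\<close>.\<close>

lemma polynomial_along_Mdir:
  assumes "q \<in> {1..n}" "z \<in> \<Omega>" "vadd z h \<in> \<Omega>" "h \<in> Mdir k e (blk q)"
  shows "poly_on_unit q (\<lambda>t. \<Phi> (ray z h t) q)"
  using assms
proof (induction q arbitrary: z h rule: less_induct)
  case (less q)
  have h: "h \<in> Ek k e" "h (blk q) = 0" using less.prems by (auto simp: Mdir_def)
  have "poly_on_unit (q - 1) (\<lambda>t. mult_coeff m n Ups us h s q * d (ray z h t) s)"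
    if s: "s \<in> {1..n}" for s
  proof (cases "mult_coeff m n Ups us h s q = 0")
    case True
    then show ?thesis by (simp add: poly_on_unit_const)
  next
    case False
    then have sq: "s < q" and blk: "blk s = blk q"
      using mult_coeff_less[OF alg] mult_coeff_block[OF alg] s less.prems(1) h by blast+
    have "poly_on_unit s (\<lambda>t. d (ray z h t) s)"
      using less.prems sq blk s by (intro derivative_polynomial less.IH) auto
    then show ?thesis using sq by (intro poly_on_unit_cmult) (auto intro: poly_on_unit_mono)
  qed
  then have "poly_on_unit (q - 1) (\<lambda>t. mul h (d (ray z h t)) q)"
    unfolding amul_eq_mult_coeff by (rule poly_on_unit_sum)
  moreover have "((\<lambda>t. \<Phi> (ray z h t) q) has_vector_derivative mul h (d (ray z h t)) q) (at t)"
    if "t \<in> {0..1}" for t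
    using less.prems that blk_range[OF less.prems(1)] h
    by (intro deriv_along_ray[OF ray_in_domain[of z h 1 "blk q"]]) auto
  ultimately have "poly_on_unit (Suc (q - 1)) (\<lambda>t. \<Phi> (ray z h t) q)"
    by (intro poly_on_unit_antiderivative[where g = "\<lambda>t. mul h (d (ray z h t)) q"])
  then show ?case using less.prems by simp
qed

lemma derivative_polynomial_along_Mdir:
  assumes "q \<in> {1..n}" "z \<in> \<Omega>" "vadd z h \<in> \<Omega>" "h \<in> Mdir k e (blk q)"
  shows "poly_on_unit q (\<lambda>t. d (ray z h t) q)"
  using assms polynomial_along_Mdir by (intro derivative_polynomial) auto

subsection \<open>Extrapolation along the fibres\<close>

text \<open>The ray from \<open>z0\<close> reaches \<open>z\<close> at parameter 1, possibly outside
  \<open>\<Omega>\<close>. Requiring the point at parameter \<open>\<delta>\<close> to lie in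
  \<open>\<Omega>\<close> is enough, since convexity supplies the points before it.\<close>

definition base :: "nat \<Rightarrow> (nat \<Rightarrow> complex) \<Rightarrow> (nat \<Rightarrow> complex) \<Rightarrow> real \<Rightarrow> bool" where
  "base u z z0 \<delta> \<longleftrightarrow> z \<in> Ek k e \<and> z0 \<in> \<Omega> \<and> z0 u = z u \<and> 0 < \<delta> \<and> ray z0 (vsub z z0) \<delta> \<in> \<Omega>"

text \<open>With \<open>t\<close> rescaled by \<open>\<delta>\<close>, the target \<open>z\<close> is reached at \<open>t = 1/\<delta>\<close>.\<close>

definition extension_from :: "nat \<Rightarrow> (nat \<Rightarrow> complex) \<Rightarrow> (nat \<Rightarrow> complex) \<Rightarrow> real \<Rightarrow> complex" where
  "extension_from q z z0 \<delta> =
     extrapolate (Suc n) (\<lambda>t. \<Phi> (ray z0 (vsub z z0) (\<delta> * t)) q) (of_real (1 / \<delta>))"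

lemma base_Mdir: "base u z z0 \<delta> \<Longrightarrow> vsub z z0 \<in> Mdir k e u"
  using dom unfolding base_def Mdir_def by (auto simp: Ek_vsub) (simp add: vsub_def)

lemma base_ray:
  assumes "base u z z0 \<delta>" "u \<in> {1..m}" "0 \<le> t" "t \<le> \<delta>"
  shows "ray z0 (vsub z z0) t \<in> \<Omega>"
  using assms base_Mdir[OF assms(1)]
  by - (rule ray_in_domain[of z0 _ \<delta> u], auto simp: base_def Mdir_def)

lemma base_polynomial:
  assumes "q \<in> {1..n}" "base (blk q) z z0 \<delta>"
  shows "poly_on_unit n (\<lambda>t. \<Phi> (ray z0 (vsub z z0) (\<delta> * t)) q)"
    and "poly_on_unit n (\<lambda>t. d (ray z0 (vsub z z0) (\<delta> * t)) q)"
proof -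
  let ?h = "vscale \<delta> (vsub z z0)"
  have h: "?h \<in> Mdir k e (blk q)"
    using base_Mdir[OF assms(2)] by (auto simp: Mdir_def Ek_vscale) (simp add: vscale_def)
  have z: "z0 \<in> \<Omega>" "vadd z0 ?h \<in> \<Omega>"
    using assms(2) by (auto simp: base_def ray_def)
  show "poly_on_unit n (\<lambda>t. \<Phi> (ray z0 (vsub z z0) (\<delta> * t)) q)"
    using polynomial_along_Mdir[OF assms(1) z h] assms(1) unfolding ray_vscale
    by (auto intro: poly_on_unit_mono)
  show "poly_on_unit n (\<lambda>t. d (ray z0 (vsub z z0) (\<delta> * t)) q)"
    using derivative_polynomial_along_Mdir[OF assms(1) z h] assms(1) unfolding ray_vscale
    by (auto intro: poly_on_unit_mono)
qed

text \<open>If \<open>p\<close> describes the function for step \<open>\<delta>\<close>, then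
  \<open>p\<close> composed with scaling by \<open>c / \<delta>\<close> describes it for step
  \<open>c\<close>; its value at \<open>1 / c\<close> is that of \<open>p\<close> at
  \<open>1 / \<delta>\<close>.\<close>

lemma extension_from_shrink:
  assumes q: "q \<in> {1..n}" and b: "base (blk q) z z0 \<delta>" and c: "0 < c" "c \<le> \<delta>"
  shows "base (blk q) z z0 c" "extension_from q z z0 c = extension_from q z z0 \<delta>"
proof -
  have \<delta>: "0 < \<delta>" using b by (simp add: base_def)
  show "base (blk q) z z0 c"
    using base_ray[OF b blk_range[OF q]] b c by (simp add: base_def)
  obtain p where p: "degree p \<le> n"
      "\<And>t. t \<in> {0..1} \<Longrightarrow> \<Phi> (ray z0 (vsub z z0) (\<delta> * t)) q = poly p (of_real t)"
    using base_polynomial(1)[OF q b] unfolding poly_on_unit_def by blast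
  let ?p = "pcompose p [:0, of_real (c / \<delta>):]"
  have "degree ?p \<le> degree p * 1"
    by (rule order_trans[OF degree_pcompose_le]) (intro mult_left_mono, auto simp: degree_pCons_eq_if)
  then have deg: "degree ?p \<le> Suc n" using p by simp
  have "\<Phi> (ray z0 (vsub z z0) (c * t)) q = poly ?p (of_real t)" if t: "t \<in> {0..1}" for t
  proof -
    have "t * (c / \<delta>) \<le> 1 * 1" using t c \<delta> by (intro mult_mono) auto
    then have "t * (c / \<delta>) \<in> {0..1}" using t c \<delta> by auto
    from p(2)[OF this] show ?thesis using \<delta> by (simp add: poly_pcompose mult.commute)
  qed
  then have "extension_from q z z0 c = poly ?p (of_real (1 / c))"
    unfolding extension_from_def using deg by (intro extrapolate_poly) auto
  also have "\<dots> = poly p (of_real (1 / \<delta>))"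
    using c by (simp add: poly_pcompose)
  also have "\<dots> = extension_from q z z0 \<delta>"
    unfolding extension_from_def using p by (intro extrapolate_poly[symmetric]) auto
  finally show "extension_from q z z0 c = extension_from q z z0 \<delta>" .
qed

text \<open>Moving the base point with velocity \<open>h\<close>, the extrapolated value has as derivative the
  extrapolation of \<open>(1 - \<delta> t) (h d)\<^sub>q\<close> to \<open>t = 1/\<delta>\<close>, which is zero.\<close>

lemma extension_from_same_step:
  assumes q: "q \<in> {1..n}" and b: "base (blk q) z z0 \<delta>" "base (blk q) z z1 \<delta>"
  shows "extension_from q z z0 \<delta> = extension_from q z z1 \<delta>"
proof -
  let ?u = "blk q" and ?h = "vsub z1 z0" and ?N = "Suc n"
  \<comment> \<open>The parameter \<open>s\<close> moves the base point from \<open>z0\<close> to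
    \<open>z1\<close>, while \<open>t\<close> runs along the ray towards \<open>z\<close>.\<close>
  let ?pt = "\<lambda>s t. ray (ray z0 ?h s) (vsub z (ray z0 ?h s)) (\<delta> * t)"
  have u: "?u \<in> {1..m}" using blk_range[OF q] .
  have \<delta>: "0 < \<delta>" using b by (simp add: base_def)
  have h: "?h \<in> Ek k e" "?h ?u = 0"
    using b dom by (auto simp: base_def intro!: Ek_vsub) (simp add: vsub_def)
  have base: "base ?u z (ray z0 ?h s) \<delta>" if s: "s \<in> {0..1}" for s
  proof -
    have "vadd z0 ?h = z1" by (simp add: vec_defs)
    then have "ray z0 ?h s \<in> \<Omega>"
      using b s u h by - (rule ray_in_domain[of z0 ?h 1 ?u], auto simp: base_def)
    moreover have "ray z0 ?h s ?u = z ?u"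
      using b h by (simp add: ray_def vadd_def vscale_def base_def)
    moreover have "ray (ray z0 ?h s) (vsub z (ray z0 ?h s)) \<delta> \<in> \<Omega>"
    proof -
      \<comment> \<open>The points at parameter \<open>\<delta>\<close> also trace a segment inside
        the fibre, so convexity applies to them too.\<close>
      let ?a = "ray z0 (vsub z z0) \<delta>" and ?b = "ray z1 (vsub z z1) \<delta>"
      have "vadd ?a (vsub ?b ?a) = ?b" by (simp add: vec_defs)
      moreover have "?a \<in> \<Omega>" "?b \<in> \<Omega>" using b by (auto simp: base_def)
      moreover have "vsub ?b ?a ?u = 0" using b by (simp add: base_def vec_defs ray_def)
      ultimately have "ray ?a (vsub ?b ?a) s \<in> \<Omega>"
        using s u dom by - (rule ray_in_domain[of ?a _ 1 ?u], auto intro: Ek_vsub)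
      moreover have "ray ?a (vsub ?b ?a) s = ray (ray z0 ?h s) (vsub z (ray z0 ?h s)) \<delta>"
        by (simp add: ray_def vec_defs fun_eq_iff algebra_simps)
      ultimately show ?thesis by simp
    qed
    ultimately show ?thesis using b by (simp add: base_def)
  qed
  have pt: "?pt s t \<in> \<Omega>" if "s \<in> {0..1}" "t \<in> {0..1}" for s t
    using base_ray[OF base[OF that(1)] u, of "\<delta> * t"] that \<delta> by (simp add: mult_le_cancel_left1)
  \<comment> \<open>For fixed \<open>t\<close> the path in \<open>s\<close> is again straight, with
    velocity \<open>(1 - \<delta> t) h\<close>.\<close>
  have pt_ray: "?pt s t = ray (ray z0 (vsub z z0) (\<delta> * t)) (vscale (1 - \<delta> * t) ?h) s" for s t
    by (simp add: ray_def vec_defs fun_eq_iff algebra_simps)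
  have dpt: "((\<lambda>s. \<Phi> (?pt s t) q) has_vector_derivative of_real (1 - \<delta> * t) * mul ?h (d (?pt s t)) q) (at s)"
    if "s \<in> {0..1}" "t \<in> {0..1}" for s t
    using deriv_along_ray[of "ray z0 (vsub z z0) (\<delta> * t)" "vscale (1 - \<delta> * t) ?h" s q]
      pt[OF that] Ek_vscale[OF h(1)]
    unfolding pt_ray by (simp add: amul_vscale_left)
  have zero: "extrapolate ?N (\<lambda>t. of_real (1 - \<delta> * t) * mul ?h (d (?pt s t)) q) (of_real (1 / \<delta>)) = 0"
    if s: "s \<in> {0..1}" for s
  proof -
    have "poly_on_unit n (\<lambda>t. mult_coeff m n Ups us ?h j q * d (?pt s t) j)" if j: "j \<in> {1..n}" for j
    proof (cases "mult_coeff m n Ups us ?h j q = 0")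
      case True
      then show ?thesis by (simp add: poly_on_unit_const)
    next
      case False
      then have "blk j = ?u" using mult_coeff_block[OF alg j q] by blast
      then show ?thesis using base_polynomial(2)[OF j] base[OF s] by (intro poly_on_unit_cmult) simp
    qed
    then have "poly_on_unit n (\<lambda>t. mul ?h (d (?pt s t)) q)"
      unfolding amul_eq_mult_coeff by (rule poly_on_unit_sum)
    then obtain p where p: "degree p \<le> n"
        "\<And>t. t \<in> {0..1} \<Longrightarrow> mul ?h (d (?pt s t)) q = poly p (of_real t)"
      unfolding poly_on_unit_def by blast
    \<comment> \<open>This factor vanishes at \<open>1 / \<delta>\<close> and raises the degree to
      \<open>n + 1\<close>, which is why \<open>extension_from\<close> extrapolates with order
      \<open>Suc n\<close>.\<close>
    let ?p = "[:1, - of_real \<delta>:] * p"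
    have "degree ?p \<le> ?N"
      by (rule order_trans[OF degree_mult_le]) (use p \<delta> in simp)
    then have "extrapolate ?N (\<lambda>t. of_real (1 - \<delta> * t) * mul ?h (d (?pt s t)) q) (of_real (1 / \<delta>))
        = poly ?p (of_real (1 / \<delta>))"
      using p by (intro extrapolate_poly) (auto simp: algebra_simps)
    then show ?thesis using \<delta> by simp
  qed
  have "((\<lambda>s. extension_from q z (ray z0 ?h s) \<delta>) has_vector_derivative 0) (at s within {0..1})"
    if s: "s \<in> {0..1}" for s
  proof -
    have "((\<lambda>s. extension_from q z (ray z0 ?h s) \<delta>) has_vector_derivative
        extrapolate ?N (\<lambda>t. of_real (1 - \<delta> * t) * mul ?h (d (?pt s t)) q) (of_real (1 / \<delta>))) (at s)"
      unfolding extension_from_def extrapolate_def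
      by (intro has_vector_derivative_sum has_vector_derivative_mult_right dpt s) auto
    then show ?thesis using zero[OF s] by (simp add: has_vector_derivative_at_within)
  qed
  then obtain c where "\<And>s. s \<in> {0..1} \<Longrightarrow> extension_from q z (ray z0 ?h s) \<delta> = c"
    using has_vector_derivative_zero_constant[OF convex_real_interval(5)] by blast
  from this[of 0] this[of 1] show ?thesis by (simp add: vec_defs)
qed

lemma extension_from_unique:
  assumes "q \<in> {1..n}" "base (blk q) z z0 \<delta>0" "base (blk q) z z1 \<delta>1"
  shows "extension_from q z z0 \<delta>0 = extension_from q z z1 \<delta>1"
proof -
  define c where "c = min \<delta>0 \<delta>1"
  have c: "0 < c" "c \<le> \<delta>0" "c \<le> \<delta>1" using assms by (auto simp: c_def base_def)
  then show ?thesis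
    using extension_from_same_step[OF assms(1), of z z0 c z1] extension_from_shrink[OF assms(1)] assms
    by metis
qed

section \<open>The extension as a function, and its local form\<close>

text \<open>Each component uses bases in the fibre of its own block; the value 0 outside
  \<open>{1..n}\<close> keeps the result in \<open>Alg n\<close>.\<close>

definition extension :: "(nat \<Rightarrow> complex) \<Rightarrow> nat \<Rightarrow> complex" where
  "extension z q = (if q \<in> {1..n} then
     (SOME v. \<exists>z0 \<delta>. base (blk q) z z0 \<delta> \<and> v = extension_from q z z0 \<delta>) else 0)"

lemma extension_eq:
  assumes "q \<in> {1..n}" "base (blk q) z z0 \<delta>"
  shows "extension z q = extension_from q z z0 \<delta>"
proof -
  have "\<exists>v z0 \<delta>. base (blk q) z z0 \<delta> \<and> v = extension_from q z z0 \<delta>" using assms by blast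
  from someI_ex[OF this] have "\<exists>z0 \<delta>. base (blk q) z z0 \<delta> \<and> extension z q = extension_from q z z0 \<delta>"
    using assms(1) by (simp add: extension_def)
  then show ?thesis using extension_from_unique assms by metis
qed

lemma extension_on_domain:
  assumes "z \<in> \<Omega>" "q \<in> {1..n}"
  shows "extension z q = \<Phi> z q"
proof -
  have ray: "ray z (vsub z z) t = z" for t by (simp add: ray_def vec_defs)
  \<comment> \<open>The point \<open>z\<close> is its own base point: the direction is zero and the
    ray is constant.\<close>
  then have base: "base (blk q) z z 1" using assms dom by (auto simp: base_def simp del: ray_1)
  have "extension z q = extrapolate (Suc n) (\<lambda>t. \<Phi> z q) 1"
    unfolding extension_eq[OF assms(2) base] extension_from_def ray by simp
  then show ?thesis using extrapolate_poly[of "[:\<Phi> z q:]"] by simp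
qed

text \<open>Any point of \<open>\<Omega>\<close> in the fibre of \<open>z\<close> will do; openness
  provides a short initial piece of the ray.\<close>

lemma base_exists:
  assumes "z \<in> Ek k e" "u \<in> {1..m}" "z u \<in> Ddom \<Omega> u"
  shows "\<exists>z0 \<delta>. base u z z0 \<delta>"
proof -
  obtain z0 where z0: "z0 \<in> \<Omega>" "z0 u = z u" using assms by (auto simp: Ddom_def)
  have "eventually (\<lambda>t. ray z0 (vsub z z0) t \<in> \<Omega>) (at_right 0)"
    using z0 dom assms
    by (intro eventually_in_domain[of _ z0])
       (auto intro!: Ek_ray Ek_vsub always_eventually tendsto_eq_rhs[OF tendsto_ray[of _ 0]] tendsto_ident_at)
  then have "eventually (\<lambda>t. ray z0 (vsub z z0) t \<in> \<Omega> \<and> 0 < t) (at_right 0)"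
    using eventually_at_right_less by (rule eventually_conj)
  then obtain t where "ray z0 (vsub z z0) t \<in> \<Omega>" "0 < t"
    using eventually_happens'[OF trivial_limit_at_right_real] by blast
  then show ?thesis using z0 assms unfolding base_def by blast
qed

text \<open>Moving the base point together with the target keeps the direction of the ray, so near \<open>z\<close>
  the extension is a fixed linear combination of translates of \<open>\<Phi>\<close>.\<close>

lemma extension_translates:
  assumes q: "q \<in> {1..n}" and b: "base (blk q) z z0 \<delta>"
    and g: "(g \<longlongrightarrow> z) F" "eventually (\<lambda>x. g x \<in> Ek k e) F"
  shows "eventually (\<lambda>x. extension (g x) q = extrapolate (Suc n)
    (\<lambda>t. \<Phi> (vadd (ray z0 (vsub z z0) (\<delta> * t)) (vsub (g x) z)) q) (of_real (1 / \<delta>))) F"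
proof -
  have ev: "eventually (\<lambda>x. vadd w (vsub (g x) z) \<in> \<Omega>) F" if w: "w \<in> \<Omega>" for w
  proof (rule eventually_in_domain[OF _ w])
    have "((\<lambda>x. vadd w (vsub (g x) z)) \<longlongrightarrow> vadd w (vsub z z)) F"
      unfolding vec_defs by (intro tendsto_funI tendsto_intros tendsto_fun_component[OF g(1)])
    then show "((\<lambda>x. vadd w (vsub (g x) z)) \<longlongrightarrow> w) F" by (simp add: vec_defs)
    show "eventually (\<lambda>x. vadd w (vsub (g x) z) \<in> Ek k e) F"
      using g(2)
    proof eventually_elim
      case (elim x)
      then show ?case using w b dom by (auto simp: base_def intro!: Ek_vadd Ek_vsub)
    qed
  qed
  have b': "z0 \<in> \<Omega>" "ray z0 (vsub z z0) \<delta> \<in> \<Omega>" using b by (auto simp: base_def)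
  show ?thesis
    using ev[OF b'(1)] ev[OF b'(2)] g(2)
  proof eventually_elim
    case (elim x)
    let ?z0 = "vadd z0 (vsub (g x) z)"
    have ray: "ray ?z0 (vsub (g x) ?z0) t = vadd (ray z0 (vsub z z0) t) (vsub (g x) z)" for t
      by (simp add: ray_def vec_defs fun_eq_iff algebra_simps)
    have "base (blk q) (g x) ?z0 \<delta>"
      unfolding base_def ray using elim b by (auto simp: base_def vec_defs)
    from extension_eq[OF q this] show ?case by (simp add: extension_from_def ray)
  qed
qed

section \<open>Continuity and monogenicity of the extension\<close>

theorem extension_monogenic:
  "monogenic m n Ups us k e {z \<in> Ek k e. \<forall>u\<in>{1..m}. z u \<in> Ddom \<Omega> u} extension"
    (is "monogenic _ _ _ _ _ _ ?\<Pi> _")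
  unfolding monogenic_def
proof (intro conjI ballI)
  fix z show "extension z \<in> Alg n" by (auto simp: Alg_def extension_def)
next
  show "continuous_on ?\<Pi> extension"
    unfolding continuous_on_def
  proof (intro ballI tendsto_funI)
    fix z q assume z: "z \<in> ?\<Pi>"
    show "((\<lambda>x. extension x q) \<longlongrightarrow> extension z q) (at z within ?\<Pi>)"
    proof (cases "q \<in> {1..n}")
      case False
      then show ?thesis unfolding extension_def if_not_P[OF False] by simp
    next
      case q: True
      then obtain z0 \<delta> where b: "base (blk q) z z0 \<delta>"
        using base_exists[of z "blk q"] z blk_range[OF q] by blast
      let ?w = "\<lambda>t. ray z0 (vsub z z0) (\<delta> * t)"
      let ?S = "\<lambda>x. extrapolate (Suc n) (\<lambda>t. \<Phi> (vadd (?w t) (vsub x z)) q) (of_real (1 / \<delta>))"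
      have \<delta>: "0 < \<delta>" using b by (simp add: base_def)
      have id: "((\<lambda>x. x) \<longlongrightarrow> z) (at z within ?\<Pi>)" by (rule tendsto_ident_at)
      have E: "eventually (\<lambda>x. x \<in> Ek k e) (at z within ?\<Pi>)"
        unfolding eventually_at_filter by (rule always_eventually) auto
      have lim_pt: "((\<lambda>x. \<Phi> (vadd (?w t) (vsub x z)) q) \<longlongrightarrow> \<Phi> (?w t) q) (at z within ?\<Pi>)" if "t \<in> {0..1}" for t
      proof -
        have w: "?w t \<in> \<Omega>"
          using base_ray[OF b blk_range[OF q], of "\<delta> * t"] that \<delta> by (simp add: mult_le_cancel_left1)
        have lim: "((\<lambda>x. vadd (?w t) (vsub x z)) \<longlongrightarrow> ?w t) (at z within ?\<Pi>)"
        proof -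
          have "((\<lambda>x. vadd (?w t) (vsub x z)) \<longlongrightarrow> vadd (?w t) (vsub z z)) (at z within ?\<Pi>)"
            unfolding vec_defs by (intro tendsto_funI tendsto_intros tendsto_fun_component[OF id])
          then show ?thesis by (simp add: vec_defs)
        qed
        have "eventually (\<lambda>x. vadd (?w t) (vsub x z) \<in> Ek k e) (at z within ?\<Pi>)"
          using E
        proof eventually_elim
          case (elim x)
          then show ?case using w z dom by (auto intro!: Ek_vadd Ek_vsub)
        qed
        from eventually_in_domain[OF lim w this]
        show ?thesis by (rule tendsto_fun_component[OF continuous_on_tendsto_compose[OF cont lim w]])
      qed
      have lim: "(?S \<longlongrightarrow> extrapolate (Suc n) (\<lambda>t. \<Phi> (?w t) q) (of_real (1 / \<delta>))) (at z within ?\<Pi>)"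
        unfolding extrapolate_def by (intro tendsto_sum tendsto_mult tendsto_const lim_pt) auto
      have eq: "extrapolate (Suc n) (\<lambda>t. \<Phi> (?w t) q) (of_real (1 / \<delta>)) = extension z q"
        using extension_eq[OF q b] by (simp add: extension_from_def)
      have "eventually (\<lambda>x. ?S x = extension x q) (at z within ?\<Pi>)"
        using extension_translates[OF q b id E] by eventually_elim simp
      from Lim_transform_eventually[OF lim this] show ?thesis unfolding eq .
    qed
  qed
next
  fix z assume z: "z \<in> ?\<Pi>"
  then have zE: "z \<in> Ek k e" by simp
  have "\<forall>u\<in>{1..m}. \<exists>z0 \<delta>. base u z z0 \<delta>" using z base_exists by blast
  then obtain z0 \<delta> where b: "\<And>u. u \<in> {1..m} \<Longrightarrow> base u z (z0 u) (\<delta> u)" by metis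
  let ?w = "\<lambda>u t. ray (z0 u) (vsub z (z0 u)) (\<delta> u * t)"
  \<comment> \<open>The candidate derivative: \<open>d\<close> extrapolated componentwise, with one
    base per block.\<close>
  define D where "D s = (if s \<in> {1..n} then
    extrapolate (Suc n) (\<lambda>t. d (?w (blk s) t) s) (of_real (1 / \<delta> (blk s))) else 0)" for s
  have w: "?w u t \<in> \<Omega>" if u: "u \<in> {1..m}" and t: "t \<in> {0..1}" for u t
  proof -
    have "0 < \<delta> u" using b[OF u] by (simp add: base_def)
    then show ?thesis using base_ray[OF b[OF u] u, of "\<delta> u * t"] t by (simp add: mult_le_cancel_left1)
  qed
  \<comment> \<open>Component \<open>q\<close> of \<open>mul h D\<close> involves only components of
    \<open>D\<close> from the block of \<open>q\<close>. These share one base, so multiplication by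
    \<open>h\<close> commutes with the extrapolation.\<close>
  have mul_D: "mul h D q = extrapolate (Suc n) (\<lambda>t. mul h (d (?w (blk q) t)) q) (of_real (1 / \<delta> (blk q)))"
    if q: "q \<in> {1..n}" for h q
  proof -
    have "mul h D q = (\<Sum>s\<in>{1..n}. mult_coeff m n Ups us h s q *
        extrapolate (Suc n) (\<lambda>t. d (?w (blk q) t) s) (of_real (1 / \<delta> (blk q))))"
      unfolding amul_eq_mult_coeff
    proof (rule sum.cong[OF refl])
      fix s assume s: "s \<in> {1..n}"
      show "mult_coeff m n Ups us h s q * D s = mult_coeff m n Ups us h s q *
        extrapolate (Suc n) (\<lambda>t. d (?w (blk q) t) s) (of_real (1 / \<delta> (blk q)))"
        using mult_coeff_block[OF alg s q] s by (cases "mult_coeff m n Ups us h s q = 0") (auto simp: D_def)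
    qed
    also have "\<dots> = extrapolate (Suc n) (\<lambda>t. mul h (d (?w (blk q) t)) q) (of_real (1 / \<delta> (blk q)))"
      unfolding extrapolate_def amul_eq_mult_coeff sum_distrib_left
      by (subst sum.swap) (simp add: mult_ac)
    finally show ?thesis .
  qed
  have "((\<lambda>\<epsilon>. vscale (1 / \<epsilon>) (vsub (extension (vadd z (vscale \<epsilon> h))) (extension z)))
      \<longlongrightarrow> mul h D) (at_right 0)" if h: "h \<in> Ek k e" for h
  proof (rule tendsto_funI)
    fix q
    show "((\<lambda>\<epsilon>. vscale (1 / \<epsilon>) (vsub (extension (vadd z (vscale \<epsilon> h))) (extension z)) q)
        \<longlongrightarrow> mul h D q) (at_right 0)"
    proof (cases "q \<in> {1..n}")
      case False
      then show ?thesis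
        unfolding amul_outside[OF False Anm_dims(2)[OF alg]] extension_def vec_defs if_not_P[OF False]
        by simp
    next
      case q: True
      let ?u = "blk q"
      have u: "?u \<in> {1..m}" using blk_range[OF q] .
      let ?L = "\<lambda>f. extrapolate (Suc n) f (of_real (1 / \<delta> ?u))"
      have "((\<lambda>\<epsilon>. ?L (\<lambda>t. (\<Phi> (ray (?w ?u t) h \<epsilon>) q - \<Phi> (?w ?u t) q) /\<^sub>R \<epsilon>))
          \<longlongrightarrow> ?L (\<lambda>t. mul h (d (?w ?u t)) q)) (at_right 0)"
        unfolding extrapolate_def
        by (intro tendsto_sum tendsto_mult_left deriv_component w u h) auto
      \<comment> \<open>Shifting the target by \<open>\<epsilon> h\<close> shifts every sampled
        point equally, so the quotient of the extension is the extrapolation of the quotients of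
        \<open>\<Phi>\<close>.\<close>
      moreover have "eventually (\<lambda>\<epsilon>. ?L (\<lambda>t. (\<Phi> (ray (?w ?u t) h \<epsilon>) q - \<Phi> (?w ?u t) q) /\<^sub>R \<epsilon>)
          = vscale (1 / \<epsilon>) (vsub (extension (vadd z (vscale \<epsilon> h))) (extension z)) q) (at_right 0)"
      proof -
        have lim: "((\<lambda>\<epsilon>. ray z h \<epsilon>) \<longlongrightarrow> z) (at_right 0)"
          by (rule tendsto_eq_rhs[OF tendsto_ray[of _ 0]]) (auto intro: tendsto_ident_at)
        have ev: "eventually (\<lambda>\<epsilon>. ray z h \<epsilon> \<in> Ek k e) (at_right 0)"
          using Ek_ray[OF zE h] by (simp add: always_eventually)
        show ?thesis using extension_translates[OF q b[OF u] lim ev]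
        proof eventually_elim
          case (elim \<epsilon>)
          have "vadd x (vsub (ray z h \<epsilon>) z) = ray x h \<epsilon>" for x
            by (simp add: ray_def vec_defs)
          with elim have "extension (vadd z (vscale \<epsilon> h)) q = ?L (\<lambda>t. \<Phi> (ray (?w ?u t) h \<epsilon>) q)"
            by (simp add: ray_def)
          moreover have "extension z q = ?L (\<lambda>t. \<Phi> (?w ?u t) q)"
            using extension_eq[OF q b[OF u]] by (simp add: extension_from_def)
          ultimately show ?case
            unfolding extrapolate_difference_quotient by (simp only: vscale_def vsub_def)
        qed
      qed
      ultimately show ?thesis unfolding mul_D[OF q] by (rule Lim_transform_eventually)
    qed
  qed
  moreover have "D \<in> Alg n" by (auto simp: Alg_def D_def)
  ultimately show "\<exists>d\<in>Alg n. \<forall>h\<in>Ek k e.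
      ((\<lambda>\<epsilon>. vscale (1 / \<epsilon>) (vsub (extension (vadd z (vscale \<epsilon> h))) (extension z)))
         \<longlongrightarrow> mul h d) (at_right 0)"
    by blast
qed

end

theorem theorem2:
  fixes m n k :: nat and Ups :: "nat \<Rightarrow> nat \<Rightarrow> nat \<Rightarrow> complex" and us :: "nat \<Rightarrow> nat"
    and e :: "nat \<Rightarrow> nat \<Rightarrow> complex" and \<Omega> :: "(nat \<Rightarrow> complex) set"
    and \<Phi> :: "(nat \<Rightarrow> complex) \<Rightarrow> (nat \<Rightarrow> complex)"
  assumes alg: "is_Anm m n Ups us"
    and basis: "admissible_basis m n k e"
    and dom: "is_domain_in (Ek k e) \<Omega>"
    and conv: "\<forall>u\<in>{1..m}. convex_wrt (Mdir k e u) \<Omega>"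
    and surj: "\<forall>u\<in>{1..m}. (\<lambda>\<zeta>. \<zeta> u) ` Ek k e = UNIV"
    and mono: "monogenic m n Ups us k e \<Omega> \<Phi>"
  shows "\<exists>\<Psi>. monogenic m n Ups us k e {\<zeta> \<in> Ek k e. \<forall>u\<in>{1..m}. \<zeta> u \<in> Ddom \<Omega> u} \<Psi>
             \<and> (\<forall>\<zeta>\<in>\<Omega>. \<Psi> \<zeta> = \<Phi> \<zeta>)"
proof -
  have "\<forall>z\<in>\<Omega>. \<exists>w. \<forall>h\<in>Ek k e.
      ((\<lambda>\<epsilon>. vscale (1 / \<epsilon>) (vsub (\<Phi> (vadd z (vscale \<epsilon> h))) (\<Phi> z)))
         \<longlongrightarrow> amul m n Ups us h w) (at_right 0)"
    using mono unfolding monogenic_def by blast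
  from bchoice[OF this] obtain d where d: "\<And>z h. z \<in> \<Omega> \<Longrightarrow> h \<in> Ek k e \<Longrightarrow>
      ((\<lambda>\<epsilon>. vscale (1 / \<epsilon>) (vsub (\<Phi> (vadd z (vscale \<epsilon> h))) (\<Phi> z)))
         \<longlongrightarrow> amul m n Ups us h (d z)) (at_right 0)"
    by blast
  interpret monogenic_function m n k Ups us e \<Omega> \<Phi> d
    using alg basis dom conv mono d
    by unfold_locales (auto simp: admissible_basis_def is_domain_in_def monogenic_def)
  have "extension z = \<Phi> z" if z: "z \<in> \<Omega>" for z
  proof
    fix q
    \<comment> \<open>Outside the basis indices both functions vanish, so equality holds for whole
      coordinate functions.\<close>
    have "\<Phi> z q = 0" if "q \<notin> {1..n}"
      using mono z that unfolding monogenic_def Alg_def by blast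
    then show "extension z q = \<Phi> z q"
      using extension_on_domain[OF z, of q] by (cases "q \<in> {1..n}") (auto simp: extension_def)
  qed
  then show ?thesis using extension_monogenic by blast
qed

end
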